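(* For integers $n\geqslant 0$ and $s\geqslant -1$, let $\mathcal A_{n,s}$ be the set of sequences $\sigma\in\mathbb N^n$ with $\sigma_i<i+s$ for all $i$ which avoid both $100$ and $102$, let $\mathfrak a_{n,s}=|\mathcal A_{n,s}|$, and let $\mathfrak a'_{n,s}$ be the number of $\sigma\in\mathcal A_{n,s}$ that contain the value $0$ and satisfy $\sigma_1\neq 0$. Let $\mathfrak b_{n,k}$ be the number of words of length $n$ over $\{0,\dots,k-1\}$ avoiding $102$ with all letters distinct, and $\mathfrak c_{n,k}$ the number of words $\omega$ of length $n$ over $\{0,\dots,k-1\}$ avoiding $102$ such that $\omega_i=\omega_j\neq k-1$ implies $i=j$. Then for all $n\geqslant 1$, $s\geqslant 0$, $$\mathfrak a_{n,s}=\mathfrak a_{n,s-1}+\mathfrak a_{n-1,s+1}+\mathfrak a'_{n,s},$$ $$\mathfrak a'_{n,s}=\sum_{p=2}^{n}\sum_{m=1}^{s}\Big(\mathfrak c_{n-p,m}+\sum_{r=1}^{p-2}\mathfrak a_{p-1-r,s+r-m-1}\,\mathfrak b_{n-p,m}+\sum_{r=0}^{p-2}\mathfrak a'_{p-1-r,s+r-m}\,\mathfrak b_{n-p,m-1}\Big).$$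
   Context: An integer sequence contains a pattern $\rho$ (a finite integer sequence such as $100$ or $102$) if it has a subsequence order-isomorphic to $\rho$, and avoids $\rho$ otherwise. Sequences $\sigma\in\mathbb N^n$ with $\sigma_i<i+s$ for all $i$ are called $s$-shifted inversion sequences; for $s=0$ these are the inversion sequences, so $\mathfrak a_{n,0}$ counts inversion sequences of size $n$ avoiding $100$ and $102$. For $s=-1$ the definition gives $\mathfrak a_{0,-1}=1$ and $\mathfrak a_{n,-1}=0$ for $n\geqslant1$. *)

theory Defs
  imports Complex_Main "HOL-Library.Sublist"
begin

text \<open>
  Sequences and words are lists, so the entry written \<open>\<sigma>\<^sub>i\<close> with \<open>i\<close> starting
  from \<open>1\<close> is \<open>\<sigma> ! (i - 1)\<close>.
\<close>

text \<open>On linear orders, agreement of \<open><\<close> on all ordered pairs of positions also forces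
  agreement of \<open>=\<close>.\<close>

definition order_isomorphic :: "'a::linorder list \<Rightarrow> 'b::linorder list \<Rightarrow> bool" where
  "order_isomorphic xs ys \<longleftrightarrow>
     length xs = length ys \<and>
     (\<forall>i<length xs. \<forall>j<length xs. xs ! i < xs ! j \<longleftrightarrow> ys ! i < ys ! j)"

definition contains_pattern :: "'a::linorder list \<Rightarrow> 'b::linorder list \<Rightarrow> bool" where
  "contains_pattern \<sigma> \<rho> \<longleftrightarrow> (\<exists>\<tau>. subseq \<tau> \<sigma> \<and> order_isomorphic \<tau> \<rho>)"

abbreviation avoids_pattern :: "'a::linorder list \<Rightarrow> 'b::linorder list \<Rightarrow> bool" where
  "avoids_pattern \<sigma> \<rho> \<equiv> \<not> contains_pattern \<sigma> \<rho>"

text \<open>The shift is an integer because the value \<open>-1\<close> is needed. The entry at list position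
  \<open>i\<close> has index \<open>i + 1\<close>.\<close>

definition shifted_inversion_sequences :: "nat \<Rightarrow> int \<Rightarrow> nat list set" where
  "shifted_inversion_sequences n s =
     {\<sigma>. length \<sigma> = n \<and> (\<forall>i<n. int (\<sigma> ! i) < int (i + 1) + s)}"

definition A_set :: "nat \<Rightarrow> int \<Rightarrow> nat list set" where
  "A_set n s =
     {\<sigma> \<in> shifted_inversion_sequences n s.
        avoids_pattern \<sigma> [1, 0, 0 :: int] \<and> avoids_pattern \<sigma> [1, 0, 2 :: int]}"

definition a_num :: "nat \<Rightarrow> int \<Rightarrow> nat" where
  "a_num n s = card (A_set n s)"

text \<open>Containing \<open>0\<close> forces \<open>\<sigma>\<close> to be nonempty, so \<open>\<sigma> ! 0\<close> is its first entry.\<close>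

definition a'_num :: "nat \<Rightarrow> int \<Rightarrow> nat" where
  "a'_num n s = card {\<sigma> \<in> A_set n s. 0 \<in> set \<sigma> \<and> \<sigma> ! 0 \<noteq> 0}"

definition words :: "nat \<Rightarrow> nat \<Rightarrow> nat list set" where
  "words n k = {\<omega>. length \<omega> = n \<and> set \<omega> \<subseteq> {0..<k}}"

definition b_num :: "nat \<Rightarrow> nat \<Rightarrow> nat" where
  "b_num n k = card {\<omega> \<in> words n k. avoids_pattern \<omega> [1, 0, 2 :: int] \<and> distinct \<omega>}"

text \<open>The truncated subtraction \<open>k - 1\<close> is harmless: for \<open>k = 0\<close> the only word is empty.\<close>

definition c_num :: "nat \<Rightarrow> nat \<Rightarrow> nat" where
  "c_num n k = card {\<omega> \<in> words n k. avoids_pattern \<omega> [1, 0, 2 :: int] \<and>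
     (\<forall>i<n. \<forall>j<n. \<omega> ! i = \<omega> ! j \<and> \<omega> ! j \<noteq> k - 1 \<longrightarrow> i = j)}"

end

theory Submission
  imports Defs
begin

text \<open>
  If \<open>\<sigma>\<close> has no \<open>0\<close>, lower every entry by one; if \<open>\<sigma>\<close> starts with \<open>0\<close>, delete that entry. In the
  remaining case avoidance of \<open>100\<close> leaves a single \<open>0\<close>, so \<open>\<sigma> = \<pi> 0 \<tau>\<close> with \<open>\<pi>\<close> nonempty. Let
  \<open>m\<close> be the minimum of \<open>\<pi>\<close> and \<open>p\<close> the position of the \<open>0\<close>. Avoidance of \<open>102\<close> bounds
  \<open>\<tau>\<close> by \<open>m\<close>, and the only further interaction between \<open>\<pi>\<close> and \<open>\<tau>\<close> is through repeated letters:
  if \<open>\<pi>\<close> is constant, only \<open>m\<close> may repeat in \<open>\<tau>\<close>; otherwise \<open>\<tau>\<close> has distinct letters, and it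
  cannot use \<open>m\<close> if \<open>m\<close> already occurs in \<open>\<pi>\<close> after a larger entry. In the last two cases write
  \<open>\<pi> = m\<^sup>r \<xi>\<close> with \<open>r\<close> maximal. Since \<open>m\<close> is minimal, the entries \<open>m\<^sup>r\<close> take part in no
  pattern, and \<open>\<xi>\<close>, lowered by \<open>m + 1\<close> or \<open>m\<close>, is counted by \<open>\<aa>\<close> or \<open>\<aa>'\<close>.
\<close>

section \<open>Three-letter patterns as conditions on triples of entries\<close>

fun triples_wrt :: "('a \<Rightarrow> 'a \<Rightarrow> 'a \<Rightarrow> bool) \<Rightarrow> 'a list \<Rightarrow> bool" where
  "triples_wrt R [] \<longleftrightarrow> True"
| "triples_wrt R (x # xs) \<longleftrightarrow> sorted_wrt (R x) xs \<and> triples_wrt R xs"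

text \<open>A triple that lies in neither part is cut after its first or after its second entry; the
  last two conditions treat these cases.\<close>

lemma triples_wrt_append:
  "triples_wrt R (xs @ ys) \<longleftrightarrow> triples_wrt R xs \<and> triples_wrt R ys \<and>
     (\<forall>x\<in>set xs. sorted_wrt (R x) ys) \<and> (\<forall>z\<in>set ys. sorted_wrt (\<lambda>x y. R x y z) xs)"
  by (induction xs) (auto simp: sorted_wrt_append)

lemma triples_wrt_map:
  "triples_wrt R (map f xs) \<longleftrightarrow> triples_wrt (\<lambda>x y z. R (f x) (f y) (f z)) xs"
  by (induction xs) (auto simp: sorted_wrt_map)

lemma sorted_wrt_iff_subseq: "sorted_wrt R xs \<longleftrightarrow> (\<forall>a b. subseq [a, b] xs \<longrightarrow> R a b)"
proof (induction xs)
  case (Cons x xs)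
  have "(\<forall>a b. subseq [a, b] (x # xs) \<longrightarrow> R a b) \<longleftrightarrow>
      (\<forall>b\<in>set xs. R x b) \<and> (\<forall>a b. subseq [a, b] xs \<longrightarrow> R a b)"
    by (auto simp: subseq_singleton_left dest: subseq_Cons')
      (metis subseq_Cons' subseq_singleton_left)
  then show ?case
    using Cons.IH by simp
qed simp

text \<open>Connects the recursion, which can be split along appends, with subsequences, in terms of
  which patterns are defined.\<close>

lemma triples_wrt_iff_subseq:
  "triples_wrt R xs \<longleftrightarrow> (\<forall>a b c. subseq [a, b, c] xs \<longrightarrow> R a b c)"
proof (induction xs)
  case (Cons x xs)
  have "(\<forall>a b c. subseq [a, b, c] (x # xs) \<longrightarrow> R a b c) \<longleftrightarrow>
      (\<forall>b c. subseq [b, c] xs \<longrightarrow> R x b c) \<and> (\<forall>a b c. subseq [a, b, c] xs \<longrightarrow> R a b c)"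
    by (auto dest: subseq_Cons')
  then show ?case
    using Cons.IH by (simp add: sorted_wrt_iff_subseq)
qed simp

lemma order_isomorphic_triple:
  fixes u v w :: "'b::linorder"
  shows "order_isomorphic \<tau> [u, v, w] \<longleftrightarrow> (\<exists>a b c. \<tau> = [a, b, c] \<and>
    (a < b \<longleftrightarrow> u < v) \<and> (b < a \<longleftrightarrow> v < u) \<and> (a < c \<longleftrightarrow> u < w) \<and> (c < a \<longleftrightarrow> w < u) \<and>
    (b < c \<longleftrightarrow> v < w) \<and> (c < b \<longleftrightarrow> w < v))"
  unfolding order_isomorphic_def
  by (auto simp: length_Suc_conv less_Suc_eq numeral_3_eq_3 all_conj_distrib)

lemma avoids_pattern_triple:
  "avoids_pattern \<sigma> [u, v, w] \<longleftrightarrow>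
     triples_wrt (\<lambda>a b c. \<not> order_isomorphic [a, b, c] [u, v, w]) \<sigma>"
  unfolding triples_wrt_iff_subseq contains_pattern_def
  by (auto simp: order_isomorphic_triple)

lemma triples_wrt_conj:
  "triples_wrt (\<lambda>a b c. P a b c \<and> Q a b c) xs \<longleftrightarrow> triples_wrt P xs \<and> triples_wrt Q xs"
  by (auto simp: triples_wrt_iff_subseq)

definition avoids_102 :: "nat list \<Rightarrow> bool" where
  "avoids_102 = triples_wrt (\<lambda>a b c. b < a \<longrightarrow> c \<le> a)"

text \<open>For a triple with \<open>b < a\<close>, the pattern 100 means \<open>c = b\<close> and
  102 means \<open>c > a\<close>. One relation excludes both, so the two patterns are handled
  together.\<close>

definition avoids_100_102 :: "nat list \<Rightarrow> bool" where
  "avoids_100_102 = triples_wrt (\<lambda>a b c. b < a \<longrightarrow> c \<noteq> b \<and> c \<le> a)"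

lemma avoids_102_iff: "avoids_pattern \<sigma> [1, 0, 2 :: int] \<longleftrightarrow> avoids_102 \<sigma>"
  unfolding avoids_pattern_triple avoids_102_def
  by (rule arg_cong[where f = "\<lambda>R. triples_wrt R \<sigma>"])
    (auto simp: order_isomorphic_triple fun_eq_iff)

lemma avoids_100_102_iff:
  "avoids_pattern \<sigma> [1, 0, 0 :: int] \<and> avoids_pattern \<sigma> [1, 0, 2 :: int] \<longleftrightarrow> avoids_100_102 \<sigma>"
  unfolding avoids_pattern_triple avoids_100_102_def triples_wrt_conj[symmetric]
  by (rule arg_cong[where f = "\<lambda>R. triples_wrt R \<sigma>"])
    (auto simp: order_isomorphic_triple fun_eq_iff)

section \<open>Shifted bounds and the counted sets\<close>

fun shift_bounded :: "int \<Rightarrow> nat list \<Rightarrow> bool" where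
  "shift_bounded s [] \<longleftrightarrow> True"
| "shift_bounded s (x # xs) \<longleftrightarrow> int x \<le> s \<and> shift_bounded (s + 1) xs"

text \<open>Deleting the first entry lowers the index of all others by one, which raises the shift
  from \<open>s\<close> to \<open>s + 1\<close>. The first entry has index 1, and
  \<open>x < 1 + s\<close> is \<open>x \<le> s\<close>.\<close>

lemma shift_bounded_iff:
  "shift_bounded s xs \<longleftrightarrow> (\<forall>i<length xs. int (xs ! i) < int (i + 1) + s)"
proof (induction xs arbitrary: s)
  case (Cons x xs)
  have "(\<forall>i<length (x # xs). int ((x # xs) ! i) < int (i + 1) + s) \<longleftrightarrow>
      int x \<le> s \<and> (\<forall>i<length xs. int (xs ! i) < int (i + 1) + (s + 1))"
    by (simp add: All_less_Suc2 algebra_simps) auto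
  then show ?case
    using Cons.IH by simp
qed simp

lemma shift_bounded_append:
  "shift_bounded s (xs @ ys) \<longleftrightarrow> shift_bounded s xs \<and> shift_bounded (s + int (length xs)) ys"
  by (induction xs arbitrary: s) (auto simp: algebra_simps)

lemma shift_bounded_map_add:
  "shift_bounded s (map (\<lambda>x. x + k) xs) \<longleftrightarrow> shift_bounded (s - int k) xs"
  by (induction xs arbitrary: s) (auto simp: algebra_simps)

text \<open>The first entry has the strictest bound, namely \<open>s\<close>.\<close>

lemma shift_bounded_if_le: "(\<And>x. x \<in> set xs \<Longrightarrow> int x \<le> s) \<Longrightarrow> shift_bounded s xs"
proof (induction xs arbitrary: s)
  case (Cons x xs)
  have "int y \<le> s + 1" if "y \<in> set xs" for y
    using Cons.prems[of y] that by simp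
  then show ?case
    using Cons.prems[of x] Cons.IH by simp
qed simp

lemma A_set_iff: "\<sigma> \<in> A_set n s \<longleftrightarrow> length \<sigma> = n \<and> shift_bounded s \<sigma> \<and> avoids_100_102 \<sigma>"
  unfolding A_set_def shifted_inversion_sequences_def shift_bounded_iff
  using avoids_100_102_iff by auto

lemma finite_A_set [simp]: "finite (A_set n s)"
proof -
  have "A_set n s \<subseteq> {xs. set xs \<subseteq> {..nat (int n + s)} \<and> length xs = n}"
    unfolding A_set_iff shift_bounded_iff subset_iff by (fastforce simp: in_set_conv_nth)
  then show ?thesis
    using finite_lists_length_eq[of "{..nat (int n + s)}" n] finite_subset by blast
qed

definition A'_set :: "nat \<Rightarrow> int \<Rightarrow> nat list set" where
  "A'_set n s = {\<sigma> \<in> A_set n s. 0 \<in> set \<sigma> \<and> \<sigma> ! 0 \<noteq> 0}"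

lemma a'_num_eq: "a'_num n s = card (A'_set n s)"
  by (simp add: a'_num_def A'_set_def)

lemma finite_A'_set [simp]: "finite (A'_set n s)"
  by (simp add: A'_set_def)

definition B_set :: "nat \<Rightarrow> nat \<Rightarrow> nat list set" where
  "B_set n k = {\<omega>. length \<omega> = n \<and> set \<omega> \<subseteq> {0..<k} \<and> avoids_102 \<omega> \<and> distinct \<omega>}"

definition C_set :: "nat \<Rightarrow> nat \<Rightarrow> nat list set" where
  "C_set n k = {\<omega>. length \<omega> = n \<and> set \<omega> \<subseteq> {0..<k} \<and> avoids_102 \<omega> \<and>
     sorted_wrt (\<lambda>x y. x = y \<longrightarrow> y = k - 1) \<omega>}"

lemma b_num_eq: "b_num n k = card (B_set n k)"
  unfolding b_num_def B_set_def words_def avoids_102_iff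
  by (rule arg_cong[where f = card]) auto

text \<open>The condition on \<open>i\<close> and \<open>j\<close> is symmetric, so the pairs with
  \<open>i < j\<close> suffice.\<close>

lemma c_num_eq: "c_num n k = card (C_set n k)"
proof -
  have "(\<forall>i<n. \<forall>j<n. \<omega> ! i = \<omega> ! j \<and> \<omega> ! j \<noteq> k - 1 \<longrightarrow> i = j) \<longleftrightarrow>
      sorted_wrt (\<lambda>x y. x = y \<longrightarrow> y = k - 1) \<omega>"
    (is "?L \<longleftrightarrow> ?R") if "length \<omega> = n" for \<omega> :: "nat list"
  proof
    assume L: ?L
    show ?R
      unfolding sorted_wrt_iff_nth_less
    proof (intro allI impI)
      fix i j assume "i < j" "j < length \<omega>" "\<omega> ! i = \<omega> ! j"
      then show "\<omega> ! j = k - 1"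
        using L[rule_format, of i j] that by auto
    qed
  next
    assume R: ?R
    show ?L
    proof (intro allI impI)
      fix i j assume "i < n" "j < n" "\<omega> ! i = \<omega> ! j \<and> \<omega> ! j \<noteq> k - 1"
      then show "i = j"
        using R that unfolding sorted_wrt_iff_nth_less by (cases i j rule: linorder_cases) auto
    qed
  qed
  then show ?thesis
    unfolding c_num_def C_set_def words_def avoids_102_iff
    by (intro arg_cong[where f = card]) auto
qed

section \<open>The first recurrence\<close>

lemma avoids_100_102_map_add: "avoids_100_102 (map (\<lambda>x. x + k) xs) \<longleftrightarrow> avoids_100_102 xs"
  by (simp add: avoids_100_102_def triples_wrt_map)

text \<open>In both patterns the first letter exceeds the second, so a minimum in front cannot play
  the first letter; its position excludes the other two roles.\<close>

lemma avoids_100_102_Cons_min: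
  assumes "\<And>x. x \<in> set xs \<Longrightarrow> m \<le> x"
  shows "avoids_100_102 (m # xs) \<longleftrightarrow> avoids_100_102 xs"
proof -
  have "sorted_wrt (\<lambda>y z. y < m \<longrightarrow> z \<noteq> y \<and> z \<le> m) xs"
    using assms by (induction xs) force+
  then show ?thesis
    by (simp add: avoids_100_102_def)
qed

lemma avoids_100_102_replicate_min:
  assumes "\<And>x. x \<in> set xs \<Longrightarrow> m \<le> x"
  shows "avoids_100_102 (replicate r m @ xs) \<longleftrightarrow> avoids_100_102 xs"
proof (induction r)
  case (Suc r)
  have "\<And>x. x \<in> set (replicate r m @ xs) \<Longrightarrow> m \<le> x"
    using assms by auto
  then show ?case
    using Suc.IH avoids_100_102_Cons_min[of "replicate r m @ xs" m] by simp
qed simp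

lemma a_num_rec:
  assumes "n \<ge> 1" and "s \<ge> 0"
  shows "a_num n s = a_num n (s - 1) + a_num (n - 1) (s + 1) + a'_num n s"
proof -
  \<comment> \<open>Lowering all entries by one lowers the shift by one.\<close>
  have no_zero: "{\<sigma> \<in> A_set n s. 0 \<notin> set \<sigma>} = map (\<lambda>x. x + 1) ` A_set n (s - 1)"
    (is "?L = ?R")
  proof
    show "?R \<subseteq> ?L"
      by (auto simp only: A_set_iff length_map shift_bounded_map_add avoids_100_102_map_add
          set_map) auto
    show "?L \<subseteq> ?R"
    proof
      fix \<sigma> assume \<sigma>: "\<sigma> \<in> ?L"
      define \<rho> where "\<rho> = map (\<lambda>x. x - 1) \<sigma>"
      have eq: "\<sigma> = map (\<lambda>x. x + 1) \<rho>"
        unfolding \<rho>_def map_map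
        by (rule sym, rule map_idI) (use \<sigma> in \<open>auto simp: Suc_leI intro!: Suc_pred gr0I\<close>)
      have "\<rho> \<in> A_set n (s - 1)"
        using \<sigma> shift_bounded_map_add[of s 1 \<rho>] avoids_100_102_map_add[of 1 \<rho>]
        unfolding eq A_set_iff by simp
      then show "\<sigma> \<in> ?R"
        using eq by blast
    qed
  qed
  \<comment> \<open>Deleting the leading \<open>0\<close> moves the other entries one place to the
    left, which raises the shift by one.\<close>
  have lead_zero: "{\<sigma> \<in> A_set n s. \<sigma> ! 0 = 0} = (#) 0 ` A_set (n - 1) (s + 1)" (is "?L = ?R")
  proof
    show "?R \<subseteq> ?L"
      using assms by (auto simp: A_set_iff avoids_100_102_Cons_min)
    show "?L \<subseteq> ?R"
    proof
      fix \<sigma> assume \<sigma>: "\<sigma> \<in> ?L"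
      then obtain \<rho> where "\<sigma> = 0 # \<rho>"
        using assms(1) by (cases \<sigma>) (auto simp: A_set_iff)
      then show "\<sigma> \<in> ?R"
        using \<sigma> by (auto simp: A_set_iff avoids_100_102_Cons_min)
    qed
  qed
  have "A_set n s = ({\<sigma> \<in> A_set n s. 0 \<notin> set \<sigma>} \<union> {\<sigma> \<in> A_set n s. \<sigma> ! 0 = 0}) \<union> A'_set n s"
    by (auto simp: A'_set_def)
  then have "card (A_set n s) =
      card (({\<sigma> \<in> A_set n s. 0 \<notin> set \<sigma>} \<union> {\<sigma> \<in> A_set n s. \<sigma> ! 0 = 0}) \<union> A'_set n s)"
    by simp
  also have "\<dots> = card ({\<sigma> \<in> A_set n s. 0 \<notin> set \<sigma>} \<union> {\<sigma> \<in> A_set n s. \<sigma> ! 0 = 0}) + card (A'_set n s)"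
    by (intro card_Un_disjoint) (auto simp: A'_set_def)
  also have "card ({\<sigma> \<in> A_set n s. 0 \<notin> set \<sigma>} \<union> {\<sigma> \<in> A_set n s. \<sigma> ! 0 = 0}) =
      card {\<sigma> \<in> A_set n s. 0 \<notin> set \<sigma>} + card {\<sigma> \<in> A_set n s. \<sigma> ! 0 = 0}"
  proof (intro card_Un_disjoint)
    \<comment> \<open>As \<open>n \<ge> 1\<close>, \<open>\<sigma> ! 0\<close> is a genuine entry,
      so a sequence with first entry \<open>0\<close> contains \<open>0\<close>.\<close>
    have "\<sigma> ! 0 \<in> set \<sigma>" if "\<sigma> \<in> A_set n s" for \<sigma>
      using that assms(1) by (auto simp: A_set_iff intro!: nth_mem)
    then show "{\<sigma> \<in> A_set n s. 0 \<notin> set \<sigma>} \<inter> {\<sigma> \<in> A_set n s. \<sigma> ! 0 = 0} = {}"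
      by fastforce
  qed simp_all
  also have "card {\<sigma> \<in> A_set n s. 0 \<notin> set \<sigma>} = card (A_set n (s - 1))"
    unfolding no_zero by (intro card_image inj_on_subset[OF inj_mapI]) auto
  also have "card {\<sigma> \<in> A_set n s. \<sigma> ! 0 = 0} = card (A_set (n - 1) (s + 1))"
    unfolding lead_zero by (intro card_image) auto
  finally show ?thesis
    by (simp add: a_num_def a'_num_eq)
qed

section \<open>Avoidance across the single zero\<close>

lemma sorted_wrt_cong_set:
  assumes "\<And>x y. x \<in> set xs \<Longrightarrow> y \<in> set xs \<Longrightarrow> P x y \<longleftrightarrow> Q x y"
  shows "sorted_wrt P xs \<longleftrightarrow> sorted_wrt Q xs"
  using assms sorted_wrt_mono_rel[of xs P Q] sorted_wrt_mono_rel[of xs Q P] by blast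

lemma distinct_iff_sorted_wrt: "distinct xs \<longleftrightarrow> sorted_wrt (\<noteq>) xs"
  by (induction xs) auto

text \<open>Triples are sorted by where their entries lie. With \<open>0\<close> in the middle they
  bound the later letters by \<open>m\<close>; with one entry in \<open>\<pi>\<close> and two after
  the \<open>0\<close> they restrict repetitions; with two entries in \<open>\<pi>\<close> and one
  after the \<open>0\<close> they restrict the letter \<open>m\<close>, which is
  \<open>m - 1\<close> in \<open>\<omega>\<close>. The other triples through \<open>0\<close> are
  harmless.\<close>

lemma avoids_100_102_around_zero:
  assumes m: "0 < m" "m \<in> set \<pi>" and min': "\<forall>x\<in>set \<pi>. m \<le> x"
  shows "avoids_100_102 (\<pi> @ 0 # map Suc \<omega>) \<longleftrightarrow>
    avoids_100_102 \<pi> \<and> set \<omega> \<subseteq> {0..<m} \<and> avoids_102 \<omega> \<and>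
    (if \<forall>x\<in>set \<pi>. x = m then sorted_wrt (\<lambda>x y. x = y \<longrightarrow> y = m - 1) \<omega> else distinct \<omega>) \<and>
    (m - 1 \<in> set \<omega> \<longrightarrow> sorted_wrt (\<lambda>x y. \<not> (y = m \<and> m < x)) \<pi>)"
    (is "?L \<longleftrightarrow> _ \<and> ?sub \<and> ?av \<and> ?rep \<and> ?last")
proof -
  let ?R = "\<lambda>a b c :: nat. b < a \<longrightarrow> c \<noteq> b \<and> c \<le> a"
  have min: "m \<le> x" if "x \<in> set \<pi>" for x
    using min' that by blast
  have pos: "0 < x" if "x \<in> set \<pi>" for x
    using m min[OF that] by simp
  have zero: "sorted_wrt (\<lambda>x y. ?R x y 0) \<pi>"
    using pos by (simp add: sorted_wrt_iff_nth_less)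
  have L: "?L \<longleftrightarrow> avoids_100_102 \<pi> \<and> triples_wrt ?R (map Suc \<omega>) \<and>
      (\<forall>x\<in>set \<pi>. \<forall>z\<in>set \<omega>. Suc z \<le> x) \<and>
      (\<forall>x\<in>set \<pi>. sorted_wrt (?R x) (map Suc \<omega>)) \<and>
      (\<forall>z\<in>set \<omega>. sorted_wrt (\<lambda>x y. ?R x y (Suc z)) \<pi>)"
    using zero pos unfolding avoids_100_102_def triples_wrt_append
    by (simp add: ball_conj_distrib sorted_wrt_iff_nth_less[of _ \<pi>])
  have sub: "(\<forall>x\<in>set \<pi>. \<forall>z\<in>set \<omega>. Suc z \<le> x) \<longleftrightarrow> ?sub"
    using m min by (fastforce simp: Suc_le_eq)
  \<comment> \<open>All letters \<open>Suc z\<close> are at most \<open>m\<close>, so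
    \<open>Suc z\<close> can equal a smaller later entry \<open>y\<close> of \<open>\<pi>\<close>
    only if both are \<open>m\<close>.\<close>
  have last: "(\<forall>z\<in>set \<omega>. sorted_wrt (\<lambda>x y. ?R x y (Suc z)) \<pi>) \<longleftrightarrow> ?last" if sub: ?sub
  proof -
    have "sorted_wrt (\<lambda>x y. ?R x y (Suc z)) \<pi> \<longleftrightarrow>
        (z = m - 1 \<longrightarrow> sorted_wrt (\<lambda>x y. \<not> (y = m \<and> m < x)) \<pi>)" if "z \<in> set \<omega>" for z
    proof -
      have z: "Suc z \<le> m"
        using sub that by (auto simp: Suc_le_eq)
      have "sorted_wrt (\<lambda>x y. ?R x y (Suc z)) \<pi> \<longleftrightarrow>
          sorted_wrt (\<lambda>x y. z = m - 1 \<longrightarrow> \<not> (y = m \<and> m < x)) \<pi>"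
      proof (rule sorted_wrt_cong_set)
        fix x y assume "x \<in> set \<pi>" "y \<in> set \<pi>"
        then have "m \<le> x" "m \<le> y"
          using min by auto
        then show "?R x y (Suc z) \<longleftrightarrow> (z = m - 1 \<longrightarrow> \<not> (y = m \<and> m < x))"
          using z m(1) by auto
      qed
      then show ?thesis
        by (cases "z = m - 1") (simp_all add: sorted_wrt_iff_nth_less)
    qed
    then show ?thesis by auto
  qed
  \<comment> \<open>A repeated letter forms 100 with every larger entry of \<open>\<pi>\<close>.
    Only the letter \<open>m\<close> can escape, and only from entries equal to
    \<open>m\<close>.\<close>
  have rep: "(\<forall>x\<in>set \<pi>. sorted_wrt (?R x) (map Suc \<omega>)) \<longleftrightarrow> ?rep" if sub: ?sub
  proof -
    have R: "sorted_wrt (?R x) (map Suc \<omega>) \<longleftrightarrow>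
        sorted_wrt (\<lambda>u v. u = v \<longrightarrow> x = m \<and> v = m - 1) \<omega>" if "x \<in> set \<pi>" for x
      unfolding sorted_wrt_map
    proof (rule sorted_wrt_cong_set)
      fix u v assume "u \<in> set \<omega>" "v \<in> set \<omega>"
      then have "u < m" "v < m" "m \<le> x"
        using sub min[OF that] by auto
      then show "?R x (Suc u) (Suc v) \<longleftrightarrow> (u = v \<longrightarrow> x = m \<and> v = m - 1)"
        by auto
    qed
    show ?thesis
    proof (cases "\<forall>x\<in>set \<pi>. x = m")
      case True
      have "(\<forall>x\<in>set \<pi>. sorted_wrt (?R x) (map Suc \<omega>)) \<longleftrightarrow>
          (\<forall>x\<in>set \<pi>. sorted_wrt (\<lambda>u v. u = v \<longrightarrow> v = m - 1) \<omega>)"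
        using R True by (intro ball_cong) simp_all
      also have "\<dots> \<longleftrightarrow> ?rep"
        unfolding if_P[OF True] using m(2) by blast
      finally show ?thesis .
    next
      case False
      \<comment> \<open>A single entry \<open>x\<close> above \<open>m\<close> already forces
        distinctness, which in turn implies the condition for every other entry.\<close>
      then obtain x where x: "x \<in> set \<pi>" "x \<noteq> m" by auto
      have "distinct \<omega> \<longleftrightarrow> sorted_wrt (?R x) (map Suc \<omega>)"
        using R[OF x(1)] x(2) by (simp add: distinct_iff_sorted_wrt)
      moreover have "sorted_wrt (?R y) (map Suc \<omega>)" if "distinct \<omega>" "y \<in> set \<pi>" for y
        unfolding R[OF that(2)]
        by (rule sorted_wrt_mono_rel[OF _ that(1)[unfolded distinct_iff_sorted_wrt]]) simp
      ultimately show ?thesis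
        unfolding if_not_P[OF False] using x(1) by blast
    qed
  qed
  have av: "triples_wrt ?R (map Suc \<omega>) \<longleftrightarrow> ?av" if sub: ?sub and rep: ?rep
  proof -
    have rep': "sorted_wrt (\<lambda>x y. x = y \<longrightarrow> y = m - 1) \<omega>"
      using rep sorted_wrt_mono_rel[of \<omega> "(\<noteq>)" "\<lambda>x y. x = y \<longrightarrow> y = m - 1"]
      by (simp add: distinct_iff_sorted_wrt split: if_splits)
    \<comment> \<open>Avoidance of 100 within \<open>\<omega>\<close> comes for free: a repeated
      letter is \<open>m - 1\<close>, the largest of the alphabet, so no larger letter precedes
      it.\<close>
    have "triples_wrt (\<lambda>a b c. b < a \<longrightarrow> c \<noteq> b) \<omega>"
      unfolding triples_wrt_iff_subseq
    proof (intro allI impI notI)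
      fix a b c assume *: "subseq [a, b, c] \<omega>" "b < a" "c = b"
      have "subseq [b, c] \<omega>"
        using subseq_Cons'[OF *(1)] .
      then have "b = m - 1"
        using rep' * unfolding sorted_wrt_iff_subseq by blast
      moreover have "a \<in> set \<omega>"
        using list_emb_set[OF *(1), of a] by auto
      ultimately show False
        using sub * by auto
    qed
    then show ?thesis
      using triples_wrt_conj[of "\<lambda>a b c. b < a \<longrightarrow> c \<noteq> b" "\<lambda>a b c. b < a \<longrightarrow> c \<le> a" \<omega>]
      by (simp add: avoids_102_def triples_wrt_map imp_conjR)
  qed
  show ?thesis
    using L sub last rep av by meson
qed

section \<open>Decomposition at the zero\<close>

lemma card_eq_sum_fibres:
  assumes "finite A" and "finite K" and "f ` A \<subseteq> K"
  shows "card A = (\<Sum>k\<in>K. card {x \<in> A. f x = k})"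
  using sum.group[OF assms, of "\<lambda>_. 1 :: nat"] by simp

definition min_prefixes :: "nat \<Rightarrow> int \<Rightarrow> nat \<Rightarrow> nat list set" where
  "min_prefixes q s m = {\<pi> \<in> A_set q s. m \<in> set \<pi> \<and> (\<forall>x\<in>set \<pi>. m \<le> x)}"

text \<open>The pair stands for \<open>\<pi> @ 0 # map Suc \<omega>\<close>. Here \<open>p\<close>
  is the position of the \<open>0\<close>, counted from 1, and lowering the letters behind it by one
  turns them into a word over \<open>{0..<m}\<close>. The shift bound is demanded of
  \<open>\<pi>\<close> only.\<close>

definition splittings :: "nat \<Rightarrow> int \<Rightarrow> nat \<Rightarrow> nat \<Rightarrow> (nat list \<times> nat list) set" where
  "splittings n s p m = {(\<pi>, \<omega>). \<pi> \<in> min_prefixes (p - 1) s m \<and> length \<omega> = n - p \<and>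
     avoids_100_102 (\<pi> @ 0 # map Suc \<omega>)}"

lemma finite_min_prefixes [simp]: "finite (min_prefixes q s m)"
  by (simp add: min_prefixes_def)

lemma A'_set_splitE:
  assumes "\<sigma> \<in> A'_set n s"
  obtains \<pi> \<omega> where "\<sigma> = \<pi> @ 0 # map Suc \<omega>" "\<pi> \<noteq> []" "0 \<notin> set \<pi>"
proof -
  have "0 \<in> set \<sigma>" and A: "\<sigma> \<in> A_set n s" and "\<sigma> ! 0 \<noteq> 0"
    using assms by (auto simp: A'_set_def)
  then obtain \<pi> \<tau> where \<sigma>: "\<sigma> = \<pi> @ 0 # \<tau>" and \<pi>: "0 \<notin> set \<pi>"
    using split_list_first by metis
  obtain x \<pi>' where x: "\<pi> = x # \<pi>'"
    using \<sigma> \<open>\<sigma> ! 0 \<noteq> 0\<close> by (cases \<pi>) auto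
  \<comment> \<open>A second \<open>0\<close> would form 100 with the positive first entry
    \<open>x\<close>.\<close>
  have "0 \<notin> set \<tau>"
    using A \<pi> unfolding \<sigma> x A_set_iff avoids_100_102_def triples_wrt_append by auto
  then have "map Suc (map (\<lambda>x. x - 1) \<tau>) = \<tau>"
    unfolding map_map by (intro map_idI) (auto intro!: Suc_pred gr0I)
  then show thesis
    using that[of \<pi> "map (\<lambda>x. x - 1) \<tau>"] \<sigma> \<pi> x by simp
qed

lemma A'_set_eq_image:
  assumes "s \<ge> 0"
  shows "A'_set n s =
    (\<lambda>(\<pi>, \<omega>). \<pi> @ 0 # map Suc \<omega>) ` (\<Union>p\<in>{2..n}. \<Union>m\<in>{1..nat s}. splittings n s p m)"
    (is "_ = ?R")
proof
  show "A'_set n s \<subseteq> ?R"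
  proof
    fix \<sigma> assume \<sigma>: "\<sigma> \<in> A'_set n s"
    then obtain \<pi> \<omega> where eq: "\<sigma> = \<pi> @ 0 # map Suc \<omega>" and \<pi>: "\<pi> \<noteq> []" "0 \<notin> set \<pi>"
      by (rule A'_set_splitE)
    define m where "m = Min (set \<pi>)"
    have m: "m \<in> set \<pi>" "\<And>x. x \<in> set \<pi> \<Longrightarrow> m \<le> x"
      using \<pi>(1) by (auto simp: m_def)
    have A: "length \<sigma> = n" "shift_bounded s \<sigma>" "avoids_100_102 \<sigma>"
      using \<sigma> by (auto simp: A'_set_def A_set_iff)
    have pre: "\<pi> \<in> min_prefixes (length \<pi>) s m"
      using A m unfolding eq min_prefixes_def A_set_iff
      by (simp add: shift_bounded_append avoids_100_102_def triples_wrt_append)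
    \<comment> \<open>The minimum is at most the first entry, which is at most
      \<open>s\<close>.\<close>
    have "int m \<le> s"
      using A(2) m(2)[of "hd \<pi>"] \<pi>(1) by (cases \<pi>) (auto simp: eq)
    moreover have "m \<noteq> 0"
      using m(1) \<pi>(2) by metis
    ultimately have "m \<in> {1..nat s}"
      by auto
    moreover have "(\<pi>, \<omega>) \<in> splittings n s (length \<pi> + 1) m"
      using pre A unfolding splittings_def eq by auto
    moreover have "length \<pi> + 1 \<in> {2..n}"
      using \<pi>(1) A(1) unfolding eq by (cases \<pi>) auto
    ultimately show "\<sigma> \<in> ?R"
      unfolding eq by (intro image_eqI[where x = "(\<pi>, \<omega>)"] UN_I) (assumption | simp)+
  qed
  show "?R \<subseteq> A'_set n s"
  proof
    fix \<sigma> assume "\<sigma> \<in> ?R"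
    then obtain p m \<pi> \<omega> where pm: "p \<in> {2..n}" "m \<in> {1..nat s}"
      and split: "(\<pi>, \<omega>) \<in> splittings n s p m" and eq: "\<sigma> = \<pi> @ 0 # map Suc \<omega>"
      by auto
    have \<pi>: "length \<pi> = p - 1" "shift_bounded s \<pi>" "m \<in> set \<pi>" "\<forall>x\<in>set \<pi>. m \<le> x"
      and len: "length \<omega> = n - p" and av: "avoids_100_102 \<sigma>"
      using split by (auto simp: splittings_def min_prefixes_def A_set_iff eq)
    have ms: "0 < m" "int m \<le> s"
      using pm assms by auto
    have "set \<omega> \<subseteq> {0..<m}"
      using av avoids_100_102_around_zero[OF ms(1) \<pi>(3,4), of \<omega>] unfolding eq by blast
    \<comment> \<open>The letters behind the \<open>0\<close> are at most \<open>m \<le> s\<close>,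
      so they satisfy the shift bound automatically.\<close>
    then have "\<And>x. x \<in> set (map Suc \<omega>) \<Longrightarrow> int x \<le> s + int (length \<pi>) + 1"
      using ms by fastforce
    then have "shift_bounded (s + int (length \<pi>) + 1) (map Suc \<omega>)"
      by (rule shift_bounded_if_le)
    then have "shift_bounded s \<sigma>"
      using \<pi>(2) assms by (simp add: eq shift_bounded_append)
    moreover have "length \<sigma> = n"
      using pm \<pi>(1) len by (simp add: eq)
    moreover have "\<sigma> ! 0 \<noteq> 0"
      using \<pi>(3) \<pi>(4) ms(1) by (cases \<pi>) (auto simp: eq)
    ultimately show "\<sigma> \<in> A'_set n s"
      using av by (simp add: A'_set_def A_set_iff eq)
  qed
qed

lemma sorted_wrt_min_first_if_constant:
  fixes m :: nat
  shows "\<forall>x\<in>set \<pi>. x = m \<Longrightarrow> sorted_wrt (\<lambda>x y. \<not> (y = m \<and> m < x)) \<pi>"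
  by (induction \<pi>) auto

text \<open>The three classes are: \<open>\<pi>\<close> constant; \<open>\<pi>\<close> not constant
  with \<open>m\<close> only in the leading block; \<open>m\<close> occurring after a larger entry.
  In the last class \<open>\<omega>\<close> must not use \<open>m - 1\<close>, so its alphabet loses
  the top letter.\<close>

lemma splittings_eq:
  assumes "0 < m"
  shows "splittings n s p m =
    {\<pi> \<in> min_prefixes (p - 1) s m. \<forall>x\<in>set \<pi>. x = m} \<times> C_set (n - p) m \<union>
    {\<pi> \<in> min_prefixes (p - 1) s m. \<not> (\<forall>x\<in>set \<pi>. x = m) \<and>
       sorted_wrt (\<lambda>x y. \<not> (y = m \<and> m < x)) \<pi>} \<times> B_set (n - p) m \<union>
    {\<pi> \<in> min_prefixes (p - 1) s m. \<not> sorted_wrt (\<lambda>x y. \<not> (y = m \<and> m < x)) \<pi>} \<times>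
      B_set (n - p) (m - 1)" (is "_ = ?R")
proof (rule set_eqI, clarify)
  fix \<pi> \<omega> :: "nat list"
  show "(\<pi>, \<omega>) \<in> splittings n s p m \<longleftrightarrow> (\<pi>, \<omega>) \<in> ?R"
  proof (cases "\<pi> \<in> min_prefixes (p - 1) s m")
    case True
    then have \<pi>: "m \<in> set \<pi>" "\<forall>x\<in>set \<pi>. m \<le> x" "avoids_100_102 \<pi>"
      by (auto simp: min_prefixes_def A_set_iff)
    have all: "sorted_wrt (\<lambda>x y. \<not> (y = m \<and> m < x)) \<pi>" if "\<forall>x\<in>set \<pi>. x = m"
      using sorted_wrt_min_first_if_constant[OF that] .
    have "{0..<m - 1} = {0..<m} - {m - 1}"
      using assms by auto
    then have sub: "set w \<subseteq> {0..<m - 1} \<longleftrightarrow> set w \<subseteq> {0..<m} \<and> m - 1 \<notin> set w" for w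
      by blast
    have iff: "(\<pi>, \<omega>) \<in> splittings n s p m \<longleftrightarrow>
        length \<omega> = n - p \<and> avoids_100_102 (\<pi> @ 0 # map Suc \<omega>)"
      using True by (simp add: splittings_def)
    show ?thesis
      unfolding iff avoids_100_102_around_zero[OF assms \<pi>(1,2)] B_set_def C_set_def sub
      using True \<pi>(3) all by (cases "\<forall>x\<in>set \<pi>. x = m") auto
  next
    case False
    then show ?thesis
      by (auto simp: splittings_def)
  qed
qed

section \<open>Counting prefixes by the leading block of minima\<close>

lemma sorted_wrt_min_first_iff:
  fixes m :: nat
  assumes "\<And>x. x \<in> set \<pi> \<Longrightarrow> m \<le> x"
  shows "sorted_wrt (\<lambda>x y. \<not> (y = m \<and> m < x)) \<pi> \<longleftrightarrow> m \<notin> set (dropWhile ((=) m) \<pi>)"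
  using assms
proof (induction \<pi>)
  case (Cons a \<pi>)
  show ?case
  proof (cases "a = m")
    case True
    then show ?thesis
      using Cons by simp
  next
    case False
    then have "m < a"
      using Cons.prems[of a] by simp
    moreover have "sorted_wrt (\<lambda>x y. \<not> (y = m \<and> m < x)) \<pi>" if "m \<notin> set \<pi>"
      using that unfolding sorted_wrt_iff_nth_less by (metis nth_mem)
    ultimately show ?thesis
      using False by auto
  qed
qed simp

text \<open>The hypothesis makes the block of \<open>m\<close> maximal, so that \<open>r\<close> and
  \<open>\<xi>\<close> can be recovered from the list.\<close>

lemma takeWhile_dropWhile_replicate_append:
  assumes "\<xi> = [] \<or> hd \<xi> \<noteq> m"
  shows "takeWhile ((=) m) (replicate r m @ \<xi>) = replicate r m"
    and "dropWhile ((=) m) (replicate r m @ \<xi>) = \<xi>"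
  using assms by (induction r) (cases \<xi>; simp)+

lemma replicate_append_dropWhile:
  "\<pi> = replicate (length (takeWhile ((=) m) \<pi>)) m @ dropWhile ((=) m) \<pi>"
  by (induction \<pi>) auto

lemma map_add_map_minus:
  fixes k :: nat
  assumes "\<And>x. x \<in> set xs \<Longrightarrow> k \<le> x"
  shows "map (\<lambda>x. x + k) (map (\<lambda>x. x - k) xs) = xs"
  unfolding map_map by (intro map_idI) (simp add: assms)

text \<open>Removing \<open>r\<close> leading entries raises the shift by \<open>r\<close>, and
  lowering the rest by \<open>k\<close> reduces it by \<open>k\<close>. It is applied with
  \<open>k = m\<close> and \<open>k = m + 1\<close>.\<close>

lemma replicate_append_map_in_A_set_iff:
  assumes "int m \<le> s" and "m \<le> k" and "r \<le> q"
  shows "replicate r m @ map (\<lambda>x. x + k) \<rho> \<in> A_set q s \<longleftrightarrow> \<rho> \<in> A_set (q - r) (s + int r - int k)"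
proof -
  have "shift_bounded s (replicate r m)"
    using assms(1) by (intro shift_bounded_if_le) auto
  moreover have "avoids_100_102 (replicate r m @ map (\<lambda>x. x + k) \<rho>) \<longleftrightarrow> avoids_100_102 \<rho>"
    using assms(2) by (subst avoids_100_102_replicate_min) (auto simp: avoids_100_102_map_add)
  ultimately show ?thesis
    using assms(3) by (auto simp: A_set_iff shift_bounded_append shift_bounded_map_add)
qed

text \<open>Behind the leading block all entries exceed \<open>m\<close>, and lowering them by
  \<open>m + 1\<close> gives an arbitrary member of \<open>A_set\<close>. The block is nonempty
  because \<open>m\<close> occurs, and it is not all of \<open>\<pi>\<close> because
  \<open>\<pi>\<close> is not constant.\<close>

lemma card_min_prefixes_min_first:
  assumes "int m \<le> s"
  shows "card {\<pi> \<in> min_prefixes q s m. \<not> (\<forall>x\<in>set \<pi>. x = m) \<and>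
      sorted_wrt (\<lambda>x y. \<not> (y = m \<and> m < x)) \<pi>} =
    (\<Sum>r = 1..q - 1. a_num (q - r) (s + int r - int m - 1))" (is "card ?P = _")
proof -
  let ?r = "\<lambda>\<pi>. length (takeWhile ((=) m) \<pi>)"
  let ?f = "\<lambda>r \<rho>. replicate r m @ map (\<lambda>x. x + (m + 1)) \<rho>"
  have P: "\<pi> \<in> ?P \<longleftrightarrow> \<pi> \<in> A_set q s \<and> m \<in> set \<pi> \<and> (\<forall>x\<in>set \<pi>. m \<le> x) \<and>
      dropWhile ((=) m) \<pi> \<noteq> [] \<and> m \<notin> set (dropWhile ((=) m) \<pi>)" for \<pi>
    using sorted_wrt_min_first_iff[of \<pi> m]
    by (auto simp: min_prefixes_def dropWhile_eq_Nil_conv)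
  have range: "?r ` ?P \<subseteq> {1..q - 1}"
  proof (rule image_subsetI)
    fix \<pi> assume \<pi>: "\<pi> \<in> ?P"
    have "?r \<pi> \<noteq> 0"
      using \<pi> replicate_append_dropWhile[of \<pi> m] unfolding P by auto
    moreover have "length (dropWhile ((=) m) \<pi>) \<noteq> 0" "length \<pi> = q"
      using \<pi> unfolding P A_set_iff by blast+
    then have "?r \<pi> < q"
      using arg_cong[OF replicate_append_dropWhile[of \<pi> m], of length]
      unfolding length_append length_replicate by linarith
    ultimately show "?r \<pi> \<in> {1..q - 1}"
      unfolding atLeastAtMost_iff by linarith
  qed
  have fibre: "{\<pi> \<in> ?P. ?r \<pi> = r} = ?f r ` A_set (q - r) (s + int r - int m - 1)" (is "?L = ?R")
    if r: "r \<in> {1..q - 1}" for r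
  proof -
    have A: "?f r \<rho> \<in> A_set q s \<longleftrightarrow> \<rho> \<in> A_set (q - r) (s + int r - int m - 1)" for \<rho>
      using replicate_append_map_in_A_set_iff[of m s "m + 1" r q \<rho>] assms r
      by (auto simp: algebra_simps)
    show ?thesis
    proof
      show "?R \<subseteq> ?L"
      proof clarify
        fix \<rho> assume \<rho>: "\<rho> \<in> A_set (q - r) (s + int r - int m - 1)"
        define \<xi> where "\<xi> = map (\<lambda>x. x + (m + 1)) \<rho>"
        have "\<xi> \<noteq> []" and gt: "m \<notin> set \<xi>"
          using \<rho> r by (auto simp: \<xi>_def A_set_iff)
        then have "hd \<xi> \<noteq> m"
          by (metis hd_in_set)
        note tw = takeWhile_dropWhile_replicate_append[OF disjI2[OF this], of r]
        have "replicate r m @ \<xi> \<in> A_set q s"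
          using A \<rho> by (simp add: \<xi>_def)
        moreover have "\<forall>x\<in>set \<xi>. m \<le> x"
          by (auto simp: \<xi>_def)
        ultimately show "?f r \<rho> \<in> ?P \<and> ?r (?f r \<rho>) = r"
          using r tw \<open>\<xi> \<noteq> []\<close> gt unfolding P \<xi>_def[symmetric] by auto
      qed
      show "?L \<subseteq> ?R"
      proof
        fix \<pi> assume \<pi>: "\<pi> \<in> ?L"
        define \<xi> where "\<xi> = dropWhile ((=) m) \<pi>"
        have eq: "\<pi> = replicate r m @ \<xi>"
          using \<pi> replicate_append_dropWhile[of \<pi> m] by (simp add: \<xi>_def)
        have "m \<notin> set \<xi>" "\<forall>x\<in>set \<pi>. m \<le> x" "\<pi> \<in> A_set q s"
          using \<pi> P[of \<pi>] by (auto simp: \<xi>_def)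
        then have "\<And>x. x \<in> set \<xi> \<Longrightarrow> m + 1 \<le> x"
          unfolding eq by (metis Suc_eq_plus1 Suc_leI UnCI le_neq_implies_less set_append)
        then have eq': "\<pi> = ?f r (map (\<lambda>x. x - (m + 1)) \<xi>)"
          using eq map_add_map_minus by metis
        then show "\<pi> \<in> ?R"
          using A \<open>\<pi> \<in> A_set q s\<close> by blast
      qed
    qed
  qed
  have "card ?P = (\<Sum>r\<in>{1..q - 1}. card {\<pi> \<in> ?P. ?r \<pi> = r})"
    by (rule card_eq_sum_fibres[OF _ _ range]) auto
  also have "\<dots> = (\<Sum>r\<in>{1..q - 1}. a_num (q - r) (s + int r - int m - 1))"
  proof (rule sum.cong[OF refl])
    fix r assume r: "r \<in> {1..q - 1}"
    show "card {\<pi> \<in> ?P. ?r \<pi> = r} = a_num (q - r) (s + int r - int m - 1)"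
      unfolding fibre[OF r] a_num_def by (intro card_image) (auto simp: inj_on_def)
  qed
  finally show ?thesis .
qed

text \<open>Behind the leading block the list starts above \<open>m\<close> and contains
  \<open>m\<close>; lowered by \<open>m\<close>, it starts above \<open>0\<close> and contains
  \<open>0\<close>, which is membership in \<open>A'_set\<close>. The block may be empty, so
  \<open>r\<close> starts at 0.\<close>

lemma card_min_prefixes_min_later:
  assumes "int m \<le> s"
  shows "card {\<pi> \<in> min_prefixes q s m. \<not> sorted_wrt (\<lambda>x y. \<not> (y = m \<and> m < x)) \<pi>} =
    (\<Sum>r = 0..q - 1. a'_num (q - r) (s + int r - int m))" (is "card ?P = _")
proof -
  let ?r = "\<lambda>\<pi>. length (takeWhile ((=) m) \<pi>)"
  let ?f = "\<lambda>r \<rho>. replicate r m @ map (\<lambda>x. x + m) \<rho>"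
  have P: "\<pi> \<in> ?P \<longleftrightarrow> \<pi> \<in> A_set q s \<and> (\<forall>x\<in>set \<pi>. m \<le> x) \<and>
      m \<in> set (dropWhile ((=) m) \<pi>)" for \<pi>
    using sorted_wrt_min_first_iff[of \<pi> m]
    by (auto simp: min_prefixes_def dest: set_dropWhileD)
  have range: "?r ` ?P \<subseteq> {0..q - 1}"
  proof (rule image_subsetI)
    fix \<pi> assume \<pi>: "\<pi> \<in> ?P"
    then have "dropWhile ((=) m) \<pi> \<noteq> []" "length \<pi> = q"
      unfolding P by (auto simp: A_set_iff simp del: dropWhile_eq_Nil_conv)
    then show "?r \<pi> \<in> {0..q - 1}"
      using arg_cong[OF replicate_append_dropWhile[of \<pi> m], of length]
      by (cases "dropWhile ((=) m) \<pi>") auto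
  qed
  have fibre: "{\<pi> \<in> ?P. ?r \<pi> = r} = ?f r ` A'_set (q - r) (s + int r - int m)" (is "?L = ?R")
    if r: "r \<in> {0..q - 1}" for r
  proof -
    have A: "?f r \<rho> \<in> A_set q s \<longleftrightarrow> \<rho> \<in> A_set (q - r) (s + int r - int m)" for \<rho>
      using replicate_append_map_in_A_set_iff[of m s m r q \<rho>] assms r by auto
    show ?thesis
    proof
      show "?R \<subseteq> ?L"
      proof clarify
        fix \<rho> assume \<rho>: "\<rho> \<in> A'_set (q - r) (s + int r - int m)"
        define \<xi> where "\<xi> = map (\<lambda>x. x + m) \<rho>"
        have \<xi>: "m \<in> set \<xi>" and "hd \<xi> \<noteq> m"
          using \<rho> by (cases \<rho>; auto simp: \<xi>_def A'_set_def)+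
        note tw = takeWhile_dropWhile_replicate_append[OF disjI2[OF this(2)], of r]
        have "replicate r m @ \<xi> \<in> A_set q s"
          using A \<rho> by (simp add: \<xi>_def A'_set_def)
        moreover have "\<forall>x\<in>set \<xi>. m \<le> x"
          by (auto simp: \<xi>_def)
        ultimately show "?f r \<rho> \<in> ?P \<and> ?r (?f r \<rho>) = r"
          using tw \<xi> unfolding P \<xi>_def[symmetric] by auto
      qed
      show "?L \<subseteq> ?R"
      proof
        fix \<pi> assume \<pi>: "\<pi> \<in> ?L"
        define \<xi> where "\<xi> = dropWhile ((=) m) \<pi>"
        define \<rho> where "\<rho> = map (\<lambda>x. x - m) \<xi>"
        have eq: "\<pi> = replicate r m @ \<xi>"
          using \<pi> replicate_append_dropWhile[of \<pi> m] by (simp add: \<xi>_def)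
        have \<xi>: "m \<in> set \<xi>" "\<forall>x\<in>set \<pi>. m \<le> x" "\<pi> \<in> A_set q s"
          using \<pi> P[of \<pi>] by (auto simp: \<xi>_def)
        then have "\<And>x. x \<in> set \<xi> \<Longrightarrow> m \<le> x"
          unfolding eq by simp
        then have \<xi>_eq: "\<xi> = map (\<lambda>x. x + m) \<rho>"
          unfolding \<rho>_def by (rule map_add_map_minus[symmetric])
        have "\<xi> \<noteq> []"
          using \<xi>(1) by auto
        \<comment> \<open>Maximality of the leading block.\<close>
        then have "hd \<xi> \<noteq> m"
          using hd_dropWhile[of "(=) m" \<pi>] by (simp add: \<xi>_def)
        then have "\<rho> ! 0 \<noteq> 0"
          using \<open>\<xi> \<noteq> []\<close> by (cases \<rho>) (auto simp: \<xi>_eq)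
        moreover have "0 \<in> set \<rho>"
          using \<xi>(1) by (auto simp: \<xi>_eq)
        ultimately have "\<rho> \<in> A'_set (q - r) (s + int r - int m)"
          using A \<xi>(3) by (simp add: A'_set_def eq \<xi>_eq)
        then show "\<pi> \<in> ?R"
          unfolding eq \<xi>_eq by blast
      qed
    qed
  qed
  have "card ?P = (\<Sum>r\<in>{0..q - 1}. card {\<pi> \<in> ?P. ?r \<pi> = r})"
    by (rule card_eq_sum_fibres[OF _ _ range]) auto
  also have "\<dots> = (\<Sum>r\<in>{0..q - 1}. a'_num (q - r) (s + int r - int m))"
  proof (rule sum.cong[OF refl])
    fix r assume r: "r \<in> {0..q - 1}"
    show "card {\<pi> \<in> ?P. ?r \<pi> = r} = a'_num (q - r) (s + int r - int m)"
      unfolding fibre[OF r] a'_num_eq by (intro card_image) (auto simp: inj_on_def)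
  qed
  finally show ?thesis .
qed

text \<open>There is exactly one constant prefix, so the \<open>c_num\<close> term carries no
  further factor.\<close>

lemma min_prefixes_constant:
  assumes "int m \<le> s" and "q \<ge> 1"
  shows "{\<pi> \<in> min_prefixes q s m. \<forall>x\<in>set \<pi>. x = m} = {replicate q m}"
proof
  have "replicate q m \<in> A_set q s"
    using replicate_append_map_in_A_set_iff[of m s m q q "[]"] assms(1)
    by (simp add: A_set_iff avoids_100_102_def)
  then show "{replicate q m} \<subseteq> {\<pi> \<in> min_prefixes q s m. \<forall>x\<in>set \<pi>. x = m}"
    using assms(2) by (auto simp: min_prefixes_def)
  show "{\<pi> \<in> min_prefixes q s m. \<forall>x\<in>set \<pi>. x = m} \<subseteq> {replicate q m}"
    by (auto simp: min_prefixes_def A_set_iff intro: replicate_eqI)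
qed

section \<open>Assembling the second recurrence\<close>

lemma finite_words: "finite {\<omega> :: nat list. length \<omega> = n \<and> set \<omega> \<subseteq> {0..<k} \<and> P \<omega>}"
  by (rule finite_subset[OF _ finite_lists_length_eq[of "{0..<k}" n]]) auto

lemma finite_B_set [simp]: "finite (B_set n k)"
  unfolding B_set_def by (rule finite_words)

lemma finite_C_set [simp]: "finite (C_set n k)"
  unfolding C_set_def by (rule finite_words)

lemma finite_splittings: "0 < m \<Longrightarrow> finite (splittings n s p m)"
  by (simp add: splittings_eq)

text \<open>Adds up the three products of \<open>splittings_eq\<close>, with prefixes of length
  \<open>p - 1 \<ge> 1\<close>.\<close>

lemma card_splittings:
  assumes "0 < m" and "int m \<le> s" and "p \<ge> 2"
  shows "card (splittings n s p m) = c_num (n - p) m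
    + (\<Sum>r = 1..p - 2. a_num (p - 1 - r) (s + int r - int m - 1) * b_num (n - p) m)
    + (\<Sum>r = 0..p - 2. a'_num (p - 1 - r) (s + int r - int m) * b_num (n - p) (m - 1))"
proof -
  let ?P = "min_prefixes (p - 1) s m"
  let ?all = "\<lambda>\<pi>. \<forall>x\<in>set \<pi>. x = m" and ?first = "sorted_wrt (\<lambda>x y. \<not> (y = m \<and> m < x))"
  have all: "?first \<pi>" if "?all \<pi>" for \<pi>
    using sorted_wrt_min_first_if_constant[OF that] .
  have p: "p - 1 - 1 = p - 2"
    by simp
  have "card (splittings n s p m) =
      card ({\<pi> \<in> ?P. ?all \<pi>} \<times> C_set (n - p) m \<union>
        {\<pi> \<in> ?P. \<not> ?all \<pi> \<and> ?first \<pi>} \<times> B_set (n - p) m) +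
      card ({\<pi> \<in> ?P. \<not> ?first \<pi>} \<times> B_set (n - p) (m - 1))"
    unfolding splittings_eq[OF assms(1)] using all by (intro card_Un_disjoint) auto
  also have "card ({\<pi> \<in> ?P. ?all \<pi>} \<times> C_set (n - p) m \<union>
        {\<pi> \<in> ?P. \<not> ?all \<pi> \<and> ?first \<pi>} \<times> B_set (n - p) m) =
      card ({\<pi> \<in> ?P. ?all \<pi>} \<times> C_set (n - p) m) +
      card ({\<pi> \<in> ?P. \<not> ?all \<pi> \<and> ?first \<pi>} \<times> B_set (n - p) m)"
    by (intro card_Un_disjoint) auto
  finally show ?thesis
    using assms(2,3)
    by (simp only: card_cartesian_product card_min_prefixes_min_first[OF assms(2)]
        card_min_prefixes_min_later[OF assms(2)] p b_num_eq c_num_eq sum_distrib_right)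
      (simp add: min_prefixes_constant)
qed

text \<open>No sequence is counted twice: \<open>\<pi>\<close> is the part before the first
  \<open>0\<close>, and it determines \<open>p\<close> by its length and \<open>m\<close> as its
  minimum.\<close>

lemma a'_num_eq_sum_splittings:
  assumes "s \<ge> 0"
  shows "a'_num n s = (\<Sum>p = 2..n. \<Sum>m = 1..nat s. card (splittings n s p m))"
proof -
  let ?g = "\<lambda>(\<pi>, \<omega>). \<pi> @ 0 # map Suc \<omega>"
  let ?I = "{2..n} \<times> {1..nat s}"
  let ?D = "\<lambda>(p, m). splittings n s p m"
  have split: "length \<pi> = p - 1 \<and> m \<in> set \<pi> \<and> (\<forall>x\<in>set \<pi>. m \<le> x)"
    if "(\<pi>, \<omega>) \<in> splittings n s p m" for \<pi> \<omega> p m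
    using that by (auto simp: splittings_def min_prefixes_def A_set_iff)
  have inj: "inj_on ?g (\<Union>i\<in>?I. ?D i)"
  proof (rule inj_onI, clarify)
    fix \<pi> \<omega> p m \<pi>' \<omega>' p' m'
    assume "(\<pi>, \<omega>) \<in> splittings n s p m" "(\<pi>', \<omega>') \<in> splittings n s p' m'"
      "m \<in> {1..nat s}" "m' \<in> {1..nat s}"
      and eq: "\<pi> @ 0 # map Suc \<omega> = \<pi>' @ 0 # map Suc \<omega>'"
    \<comment> \<open>Entries of \<open>\<pi>\<close> are at least \<open>m \<ge> 1\<close>.\<close>
    then have "0 \<notin> set \<pi>" "0 \<notin> set \<pi>'"
      using split by fastforce+
    then have "takeWhile ((\<noteq>) 0) (\<pi> @ 0 # map Suc \<omega>) = \<pi>"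
      "takeWhile ((\<noteq>) 0) (\<pi>' @ 0 # map Suc \<omega>') = \<pi>'"
      by (auto simp: takeWhile_append intro!: takeWhile_eq_all_conv[THEN iffD2])
    then have "\<pi> = \<pi>'"
      using eq by simp
    then show "\<pi> = \<pi>' \<and> \<omega> = \<omega>'"
      using eq by (simp add: inj_map_eq_map)
  qed
  have "A'_set n s = ?g ` (\<Union>i\<in>?I. ?D i)"
    unfolding A'_set_eq_image[OF assms] by (rule arg_cong[where f = "(`) ?g"]) auto
  then have "a'_num n s = card (\<Union>i\<in>?I. ?D i)"
    unfolding a'_num_eq using card_image[OF inj] by simp
  also have "\<dots> = (\<Sum>i\<in>?I. card (?D i))"
  proof (rule card_UN_disjoint)
    show "\<forall>i\<in>?I. finite (?D i)"
      by (auto simp: finite_splittings)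
    show "\<forall>i\<in>?I. \<forall>j\<in>?I. i \<noteq> j \<longrightarrow> ?D i \<inter> ?D j = {}"
    proof (intro ballI impI, rule ccontr)
      fix i j assume ij: "i \<in> ?I" "j \<in> ?I" "i \<noteq> j" "?D i \<inter> ?D j \<noteq> {}"
      obtain p m p' m' where i: "i = (p, m)" and j: "j = (p', m')"
        by (metis surj_pair)
      obtain \<pi> \<omega> where "(\<pi>, \<omega>) \<in> splittings n s p m" "(\<pi>, \<omega>) \<in> splittings n s p' m'"
        using ij(4) unfolding i j by auto
      then have "p - 1 = p' - 1" "m = m'"
        using split by (metis, metis le_antisym)
      \<comment> \<open>Since \<open>p\<close> and \<open>p'\<close> are at least 2, the truncated
        \<open>p - 1 = p' - 1\<close> gives \<open>p = p'\<close>.\<close>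
      then show False
        using ij(1-3) unfolding i j by auto
    qed
  qed simp
  also have "\<dots> = (\<Sum>p = 2..n. \<Sum>m = 1..nat s. card (splittings n s p m))"
    by (simp add: sum.cartesian_product case_prod_unfold)
  finally show ?thesis .
qed

theorem theorem23:
  fixes n :: nat and s :: int
  assumes "n \<ge> 1" and "s \<ge> 0"
  shows "a_num n s = a_num n (s - 1) + a_num (n - 1) (s + 1) + a'_num n s
    \<and> a'_num n s =
        (\<Sum>p = 2..n. \<Sum>m = 1..nat s.
           c_num (n - p) m
           + (\<Sum>r = 1..p - 2. a_num (p - 1 - r) (s + int r - int m - 1) * b_num (n - p) m)
           + (\<Sum>r = 0..p - 2. a'_num (p - 1 - r) (s + int r - int m) * b_num (n - p) (m - 1)))"
proof (rule conjI[OF a_num_rec[OF assms]])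
  show "a'_num n s = (\<Sum>p = 2..n. \<Sum>m = 1..nat s.
           c_num (n - p) m
           + (\<Sum>r = 1..p - 2. a_num (p - 1 - r) (s + int r - int m - 1) * b_num (n - p) m)
           + (\<Sum>r = 0..p - 2. a'_num (p - 1 - r) (s + int r - int m) * b_num (n - p) (m - 1)))"
    unfolding a'_num_eq_sum_splittings[OF assms(2)]
    by (intro sum.cong refl card_splittings) auto
qed

end
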